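(* Let $L(\lambda)=\lambda M+K\in\mathbb{R}^{n\times n}[\lambda]$ with $M=M^T$ positive definite and $K^T=-K$. Let $\lambda_i^c,\overline{\lambda_i^c}$, $1\le i\le p$, be nonzero (hence purely imaginary) eigenvalues of $L(\lambda)$ with eigenvectors $x_i^c,\overline{x_i^c}\in\mathbb{C}^n$, normalized such that $X_c^*MX_c=2I_{2p}$ for $X_c=[x_1^c\ \overline{x_1^c}\ \cdots\ x_p^c\ \overline{x_p^c}]$. Set $$\hat X_c=[\mathrm{re}(x_1^c)\ \mathrm{im}(x_1^c)\ \cdots\ \mathrm{re}(x_p^c)\ \mathrm{im}(x_p^c)],$$ so that $\hat X_c^TM\hat X_c=I_{2p}$. Let $\lambda_1^a,\dots,\lambda_p^a$ be purely imaginary numbers, and let $\Lambda_c=\mathrm{diag}(\Lambda_1^c,\dots,\Lambda_p^c)$, $\Lambda_a=\mathrm{diag}(\Lambda_1^a,\dots,\Lambda_p^a)$ with $$\Lambda_j^c=\begin{bmatrix}0&\mathrm{im}(\lambda_j^c)\\-\mathrm{im}(\lambda_j^c)&0\end{bmatrix},\qquad \Lambda_j^a=\begin{bmatrix}0&\mathrm{im}(\lambda_j^a)\\-\mathrm{im}(\lambda_j^a)&0\end{bmatrix}.$$ Let $(X_f,\Lambda_f)$ be a deflating pair of $L(\lambda)$ complementary to $(\hat X_c,\Lambda_c)$ such that $\sigma(\Lambda_c)\cap\sigma(-\Lambda_f^T)=\emptyset$. For arbitrary $\alpha_j,\beta_j\in\mathbb{R}$ $(1\le j\le p)$ let $Z_k=\mathrm{diag}(Z_{11}^{(k)},\dots,Z_{pp}^{(k)})$,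 $k=1,2$, with $Z_{jj}^{(1)}=\alpha_jI_2$ and $Z_{jj}^{(2)}=\begin{bmatrix}0&\beta_j\\-\beta_j&0\end{bmatrix}$. Put $H_a=(I_{2p}-\Lambda_a^2)^{-1}$ and $$\hat M=H_a\left[(\Lambda_a-\Lambda_c)\Lambda_a+Z_1+Z_2\Lambda_a\right],\qquad \hat K=H_a\left[(\Lambda_c-\Lambda_a)-Z_1\Lambda_a-Z_2\Lambda_a^2\right],$$ $$\Delta M=M\hat X_c\hat M\hat X_c^TM,\qquad \Delta K=M\hat X_c\hat K\hat X_c^TM.$$ Then $(\hat X_c,\Lambda_a)$ and $(X_f,\Lambda_f)$ are complementary deflating pairs of $L_\Delta(\lambda)=\lambda(M+\Delta M)+(K+\Delta K)$, and $L_\Delta(\lambda)$ is a real $T$-odd pencil. Moreover, if $Z_1$ and $Z_2$ are chosen such that $(\Lambda_a-\Lambda_c)\Lambda_a+Z_1+Z_2\Lambda_a$ is a diagonal matrix with non-negative diagonal entries, then $\Delta M$ is positive semi-definite, and hence $M+\Delta M$ is positive definite.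
   Context: A pencil $\lambda M+K$ is $T$-odd if $M^T=M$ and $K^T=-K$. A deflating pair of a pencil $\lambda M+K\in\mathbb{C}^{n\times n}[\lambda]$ is a matrix pair $(X,\Lambda)\in\mathbb{C}^{n\times p}\times\mathbb{C}^{p\times p}$ with $\operatorname{rank}X=p\le n$ and $MX\Lambda+KX=0$ ($\Lambda$ need not be diagonal). Two deflating pairs $(X_1,\Lambda_1)$, $(X_2,\Lambda_2)$ are complementary if $[X_1\ X_2]$ is a nonsingular square matrix. $\sigma(\Lambda)$ is the spectrum of $\Lambda$; $\mathrm{re}$ and $\mathrm{im}$ denote (entrywise) real and imaginary parts. *)

theory Defs
  imports
    Complex_Main
    "Jordan_Normal_Form.Spectral_Radius"
    "Jordan_Normal_Form.Schur_Decomposition"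
    "Jordan_Normal_Form.Gauss_Jordan_Elimination"
    "Jordan_Normal_Form.DL_Rank"
begin

text \<open>A pencil \<open>\<lambda> M + K\<close> is given by its coefficient matrices \<open>M\<close> and \<open>K\<close>. Real pencils have
  coefficients of type \<open>real mat\<close> and are embedded into the complex matrices by \<open>cmat\<close>.\<close>

abbreviation cmat :: "real mat \<Rightarrow> complex mat" where
  "cmat \<equiv> map_mat complex_of_real"

definition pencil_eval :: "'a::comm_ring_1 mat \<Rightarrow> 'a mat \<Rightarrow> 'a \<Rightarrow> 'a mat" where
  "pencil_eval M K z = z \<cdot>\<^sub>m M + K"

definition pencil_eigenvector ::
    "nat \<Rightarrow> 'a::comm_ring_1 mat \<Rightarrow> 'a mat \<Rightarrow> 'a vec \<Rightarrow> 'a \<Rightarrow> bool" where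
  "pencil_eigenvector n M K v z \<longleftrightarrow>
     v \<in> carrier_vec n \<and> v \<noteq> 0\<^sub>v n \<and> pencil_eval M K z *\<^sub>v v = 0\<^sub>v n"

definition T_odd :: "nat \<Rightarrow> 'a::comm_ring_1 mat \<Rightarrow> 'a mat \<Rightarrow> bool" where
  "T_odd n M K \<longleftrightarrow> M \<in> carrier_mat n n \<and> K \<in> carrier_mat n n \<and> M\<^sup>T = M \<and> K\<^sup>T = - K"

definition pos_def :: "nat \<Rightarrow> real mat \<Rightarrow> bool" where
  "pos_def n A \<longleftrightarrow> A \<in> carrier_mat n n \<and> A\<^sup>T = A \<and>
     (\<forall>v \<in> carrier_vec n. v \<noteq> 0\<^sub>v n \<longrightarrow> v \<bullet> (A *\<^sub>v v) > 0)"

definition pos_semidef :: "nat \<Rightarrow> real mat \<Rightarrow> bool" where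
  "pos_semidef n A \<longleftrightarrow> A \<in> carrier_mat n n \<and> A\<^sup>T = A \<and>
     (\<forall>v \<in> carrier_vec n. v \<bullet> (A *\<^sub>v v) \<ge> 0)"

definition deflating_pair ::
    "nat \<Rightarrow> complex mat \<Rightarrow> complex mat \<Rightarrow> complex mat \<times> complex mat \<Rightarrow> bool" where
  "deflating_pair n M K = (\<lambda>(X, \<Lambda>). \<exists>p. p \<le> n \<and> X \<in> carrier_mat n p \<and> \<Lambda> \<in> carrier_mat p p \<and>
     vec_space.rank n X = p \<and> M * X * \<Lambda> + K * X = 0\<^sub>m n p)"

definition append_columns :: "'a mat \<Rightarrow> 'a mat \<Rightarrow> 'a mat" where
  "append_columns A B = mat_of_cols (dim_row A) (cols A @ cols B)"

text \<open>\<open>invertible_mat\<close> includes squareness.\<close>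

definition complementary ::
    "complex mat \<times> complex mat \<Rightarrow> complex mat \<times> complex mat \<Rightarrow> bool" where
  "complementary = (\<lambda>(X\<^sub>1, \<Lambda>\<^sub>1) (X\<^sub>2, \<Lambda>\<^sub>2). invertible_mat (append_columns X\<^sub>1 X\<^sub>2))"

text \<open>In the following, \<open>p\<close>-tuples are functions on \<open>nat\<close> whose values at \<open>0, ..., p - 1\<close> matter.\<close>

definition conj_pair_mat :: "nat \<Rightarrow> nat \<Rightarrow> (nat \<Rightarrow> complex vec) \<Rightarrow> complex mat" where
  "conj_pair_mat n p x = mat_of_cols n (concat (map (\<lambda>i. [x i, conjugate (x i)]) [0..<p]))"

definition re_im_mat :: "nat \<Rightarrow> nat \<Rightarrow> (nat \<Rightarrow> complex vec) \<Rightarrow> real mat" where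
  "re_im_mat n p x =
     mat_of_cols n (concat (map (\<lambda>i. [map_vec Re (x i), map_vec Im (x i)]) [0..<p]))"

definition skew_block :: "real \<Rightarrow> real mat" where
  "skew_block t = mat_of_rows_list 2 [[0, t], [- t, 0]]"

definition block_diag :: "nat \<Rightarrow> (nat \<Rightarrow> real mat) \<Rightarrow> real mat" where
  "block_diag p B = diag_block_mat (map B [0..<p])"

text \<open>The library function \<open>mat_inverse\<close> returns an option; \<open>mat_inv A\<close> is meaningful only for
  invertible \<open>A\<close>.\<close>

definition mat_inv :: "'a::field mat \<Rightarrow> 'a mat" where
  "mat_inv A = the (mat_inverse A)"

end

theory Submission
  imports Defs
begin

text \<open>
  The map \<open>rot\<close> represents a complex number by a real matrix of order two, and all of \<open>La\<close>, \<open>Lc\<close>, \<open>Z1\<close>,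
  \<open>Z2\<close>, \<open>Ha\<close>, \<open>Mh\<close>, \<open>Kh\<close> are block diagonal with such blocks. They therefore multiply like \<open>p\<close>-tuples
  of complex numbers: \<open>La\<close>, \<open>Lc\<close>, \<open>Z2\<close> are imaginary and \<open>Z1\<close>, \<open>Ha\<close> real. Since transposition is complex
  conjugation, \<open>Mh\<close>, being real, is symmetric, and \<open>Kh\<close>, being imaginary, is skew-symmetric; this gives the
  structure of the updated pencil (\<open>T_odd_update\<close>). The formulas for \<open>Mh\<close> and \<open>Kh\<close> are one solution family
  of the single equation \<open>Mh * La + Kh = Lc - La\<close>. Because \<open>Xh\<^sup>T * M * Xh = 1\<close>, this equation says exactly
  that the updated pencil has the pair \<open>(Xh, La)\<close> where the old one had \<open>(Xh, Lc)\<close>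
  (\<open>update_replaces_pair\<close>).

  The other pair survives because it is orthogonal to \<open>Xh\<close> with respect to \<open>M\<close>: the symmetries of the
  pencil give \<open>S * Lf = Lc * S\<close> for \<open>S = Xh\<^sup>T * M * Xf\<close> (\<open>pairs_bilinear\<close>). After diagonalizing \<open>Lc\<close>, a nonzero
  row of \<open>S\<close> would be an eigenvector of \<open>- Lf\<^sup>T\<close> whose eigenvalue lies in the spectrum of \<open>Lc\<close>, which
  is symmetric under negation; the spectral condition forbids this (\<open>diagonal_intertwiner_zero\<close>). So
  \<open>S = 0\<close>, and the updates, having the right factor \<open>Xh\<^sup>T * M\<close>, vanish on \<open>Xf\<close> (\<open>update_keeps_pair\<close>).

  The hypotheses speak of complex eigenvectors and their conjugates, the conclusion of real and imaginary
  parts. The matrix \<open>conj_basis p\<close> translates: it maps the columns of \<open>Xh\<close> to those of \<open>Xc\<close>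
  (\<open>conj_pair_mat_eq\<close>), it diagonalizes every \<open>rot_diag p z\<close> (\<open>rot_diag_conj_basis\<close>), and it can be cancelled,
  being unitary up to a factor (\<open>conj_basis_adjoint\<close>).

  Being real, \<open>Mh\<close> is a diagonal matrix, and \<open>Ha\<close> scales the blocks by positive reals. If the other
  factor of \<open>Mh\<close> has a non-negative diagonal, then so has \<open>Mh\<close>, and \<open>DM\<close> is a congruence of it
  (\<open>congruence_pos_semidef\<close>).
\<close>

section \<open>Matrix algebra with dimension side conditions\<close>

text \<open>Here and below, side conditions compare dimensions instead of naming carriers, so that the
  simplifier can discharge them and normalise whole matrix products.\<close>
lemma mult_assoc_dim:
  fixes A B C :: "'a::semiring_0 mat"
  assumes "dim_col A = dim_row B" "dim_col B = dim_row C"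
  shows "A * B * C = A * (B * C)"
  by (rule assoc_mult_mat[of A "dim_row A" "dim_col A" B "dim_col B" C "dim_col C"]) (use assms in auto)

lemma mult_add_dim:
  fixes A B C :: "'a::semiring_0 mat"
  assumes "dim_col A = dim_row B" "dim_row B = dim_row C" "dim_col B = dim_col C"
  shows "A * (B + C) = A * B + A * C"
  by (rule mult_add_distrib_mat[of A "dim_row A" "dim_col A" B "dim_col B" C]) (use assms in auto)

lemma add_mult_dim:
  fixes A B C :: "'a::semiring_0 mat"
  assumes "dim_col A = dim_row C" "dim_row A = dim_row B" "dim_col A = dim_col B"
  shows "(A + B) * C = A * C + B * C"
  by (rule add_mult_distrib_mat[of A "dim_row A" "dim_col A" B C "dim_col C"]) (use assms in auto)

lemma transpose_mult_dim:
  fixes A B :: "'a::comm_semiring_0 mat"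
  assumes "dim_col A = dim_row B"
  shows "(A * B)\<^sup>T = B\<^sup>T * A\<^sup>T"
  by (rule transpose_mult[of A "dim_row A" "dim_col A" B "dim_col B"]) (use assms in auto)

lemma mult_smult_dim:
  fixes A B :: "'a::comm_semiring_0 mat"
  assumes "dim_col A = dim_row B"
  shows "A * (c \<cdot>\<^sub>m B) = c \<cdot>\<^sub>m (A * B)" "(c \<cdot>\<^sub>m A) * B = c \<cdot>\<^sub>m (A * B)"
proof -
  show "A * (c \<cdot>\<^sub>m B) = c \<cdot>\<^sub>m (A * B)"
    by (rule mult_smult_distrib[of A "dim_row A" "dim_col A" B "dim_col B"]) (use assms in auto)
  show "(c \<cdot>\<^sub>m A) * B = c \<cdot>\<^sub>m (A * B)"
    by (rule mult_smult_assoc_mat[of A "dim_row A" "dim_col A" B "dim_col B"]) (use assms in auto)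
qed

lemma mult_uminus_dim:
  fixes A B :: "'a::comm_ring_1 mat"
  assumes "dim_col A = dim_row B"
  shows "A * (- B) = - (A * B)" "(- A) * B = - (A * B)"
  using assms by (auto intro!: eq_matI)

lemma mult_zero_dim:
  fixes A :: "'a::comm_semiring_1 mat"
  shows "dim_col A = m \<Longrightarrow> A * 0\<^sub>m m k = 0\<^sub>m (dim_row A) k"
    "dim_row A = m \<Longrightarrow> 0\<^sub>m k m * A = 0\<^sub>m k (dim_col A)"
  by auto

lemma smult_cancel:
  fixes A B :: "'a::field mat"
  assumes "c \<cdot>\<^sub>m A = c \<cdot>\<^sub>m B" "c \<noteq> 0"
  shows "A = B"
proof (rule eq_matI)
  have dims: "dim_row A = dim_row B" "dim_col A = dim_col B"
    using arg_cong[OF assms(1), of dim_row] arg_cong[OF assms(1), of dim_col] by auto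
  then show "dim_row A = dim_row B" "dim_col A = dim_col B" by auto
  fix i j assume "i < dim_row B" "j < dim_col B"
  then show "A $$ (i,j) = B $$ (i,j)"
    using arg_cong[OF assms(1), of "\<lambda>Z. Z $$ (i,j)"] assms(2) dims by auto
qed

lemma eq_uminus_mat:
  fixes A B :: "'a::comm_ring_1 mat"
  assumes "A + B = 0\<^sub>m n m" "A \<in> carrier_mat n m" "B \<in> carrier_mat n m"
  shows "B = - A"
proof (rule eq_matI)
  fix i j assume "i < dim_row (- A)" "j < dim_col (- A)"
  then show "B $$ (i,j) = (- A) $$ (i,j)"
    using arg_cong[OF assms(1), of "\<lambda>Z. Z $$ (i,j)"] assms(2,3)
    by (auto simp: eq_neg_iff_add_eq_0 add.commute)
qed (use assms in auto)

lemmas mat_dim_simps = mult_assoc_dim mult_add_dim add_mult_dim transpose_mult_dim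
  mult_smult_dim mult_uminus_dim mult_zero_dim

lemma cmat_mult:
  assumes "dim_col A = dim_row B"
  shows "cmat (A * B) = cmat A * cmat B"
  by (rule of_real_hom.mat_hom_mult[of A "dim_row A" "dim_col A" B "dim_col B"]) (use assms in auto)

lemma cmat_add:
  assumes "dim_row A = dim_row B" "dim_col A = dim_col B"
  shows "cmat (A + B) = cmat A + cmat B"
  using assms by (auto intro!: eq_matI)

lemma cmat_inj: "cmat A = cmat B \<Longrightarrow> A = B"
  by (rule of_real_hom.mat_hom_inj)

lemma cmat_transpose: "cmat A\<^sup>T = (cmat A)\<^sup>T"
  by (rule eq_matI) auto

lemma cmat_one: "cmat (1\<^sub>m m) = 1\<^sub>m m"
  by (rule eq_matI) auto

lemma cmat_zero: "cmat (0\<^sub>m n m) = 0\<^sub>m n m"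
  by (rule eq_matI) auto

section \<open>Adjoints of complex matrices\<close>

lemma mat_adjoint_alt: "mat_adjoint A = map_mat conjugate A\<^sup>T"
  by (rule eq_matI) (auto simp: mat_adjoint_def mat_of_rows_index)

lemma mat_adjoint_dim [simp]:
  "dim_row (mat_adjoint A) = dim_col A" "dim_col (mat_adjoint A) = dim_row A"
  by (auto simp: mat_adjoint_alt)

lemma mat_adjoint_mult:
  fixes A B :: "complex mat"
  assumes "dim_col A = dim_row B"
  shows "mat_adjoint (A * B) = mat_adjoint B * mat_adjoint A"
  using assms by (auto intro!: eq_matI sum.cong simp: mat_adjoint_alt scalar_prod_def mult.commute)

lemma mat_adjoint_cmat: "mat_adjoint (cmat A) = cmat A\<^sup>T"
  by (rule eq_matI) (auto simp: mat_adjoint_alt)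

lemma mat_adjoint_adjoint: "mat_adjoint (mat_adjoint A) = (A :: complex mat)"
  by (rule eq_matI) (auto simp: mat_adjoint_alt)

section \<open>Block diagonal matrices\<close>

lemma diag_block_mat_map_carrier:
  assumes "\<And>j. j \<in> set js \<Longrightarrow> F j \<in> carrier_mat k k"
  shows "diag_block_mat (map F js) \<in> carrier_mat (k * length js) (k * length js)"
  using assms by (induct js) (auto simp: Let_def)

lemma diag_block_mat_map_mult:
  fixes F G :: "'b \<Rightarrow> 'a::comm_ring_1 mat"
  assumes "\<And>j. j \<in> set js \<Longrightarrow> F j \<in> carrier_mat k k" "\<And>j. j \<in> set js \<Longrightarrow> G j \<in> carrier_mat k k"
  shows "diag_block_mat (map F js) * diag_block_mat (map G js)
    = diag_block_mat (map (\<lambda>j. F j * G j) js)"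
  using assms
proof (induct js)
  case (Cons j js)
  let ?m = "k * length js"
  have c: "F j \<in> carrier_mat k k" "G j \<in> carrier_mat k k"
    "diag_block_mat (map F js) \<in> carrier_mat ?m ?m"
    "diag_block_mat (map G js) \<in> carrier_mat ?m ?m"
    "diag_block_mat (map (\<lambda>j. F j * G j) js) \<in> carrier_mat ?m ?m"
    using Cons.prems by (auto intro!: diag_block_mat_map_carrier mult_carrier_mat)
  have IH: "diag_block_mat (map F js) * diag_block_mat (map G js)
    = diag_block_mat (map (\<lambda>j. F j * G j) js)"
    using Cons by auto
  have d: "dim_row (F j) = k" "dim_col (F j) = k" "dim_row (G j) = k" "dim_col (G j) = k"
     "dim_row (diag_block_mat (map F js)) = ?m" "dim_col (diag_block_mat (map F js)) = ?m"
     "dim_row (diag_block_mat (map G js)) = ?m" "dim_col (diag_block_mat (map G js)) = ?m"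
     "dim_row (diag_block_mat (map (\<lambda>j. F j * G j) js)) = ?m"
     "dim_col (diag_block_mat (map (\<lambda>j. F j * G j) js)) = ?m"
    using c by auto
  show ?case unfolding list.map diag_block_mat.simps Let_def index_mult_mat d
    by (subst mult_four_block_mat[OF c(1) zero_carrier_mat zero_carrier_mat c(3)
          c(2) zero_carrier_mat zero_carrier_mat c(4)]) (use c IH in auto)
qed auto

lemma diag_block_mat_map_index:
  assumes "\<And>j. j \<in> set js \<Longrightarrow> F j \<in> carrier_mat k k" "i < k * length js" "l < k * length js"
  shows "diag_block_mat (map F js) $$ (i, l) =
    (if i div k = l div k then F (js ! (i div k)) $$ (i mod k, l mod k) else 0)"
  using assms
proof (induct js arbitrary: i l)
  case (Cons j js)
  let ?m = "k * length js"
  have c: "F j \<in> carrier_mat k k" "diag_block_mat (map F js) \<in> carrier_mat ?m ?m"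
    using Cons.prems by (auto intro!: diag_block_mat_map_carrier)
  have k: "k > 0" using Cons.prems by (cases k) auto
  have div: "a div k = Suc ((a - k) div k)" "a mod k = (a - k) mod k" if "\<not> a < k" for a
    using that k by (auto simp: le_div_geq le_mod_geq)
  have IH: "diag_block_mat (map F js) $$ (i - k, l - k) =
    (if (i - k) div k = (l - k) div k then F (js ! ((i - k) div k)) $$ ((i - k) mod k, (l - k) mod k) else 0)"
    if "\<not> i < k" "\<not> l < k"
    using that Cons.prems by (intro Cons.hyps) auto
  have d: "dim_row (F j) = k" "dim_col (F j) = k" "dim_row (diag_block_mat (map F js)) = ?m"
    "dim_col (diag_block_mat (map F js)) = ?m" and il: "i < k + ?m" "l < k + ?m"
    using c Cons.prems by auto
  have "diag_block_mat (map F (j # js)) $$ (i, l) =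
    (if i < k then if l < k then F j $$ (i, l) else 0
     else if l < k then 0 else diag_block_mat (map F js) $$ (i - k, l - k))"
    using il by (simp add: Let_def d)
  then show ?case
    using IH div[of i] div[of l] by (cases "i < k"; cases "l < k") simp_all
qed auto

text \<open>Lets a block diagonal matrix be computed entrywise, which is how the linear (as opposed to
  multiplicative) operations are transferred to the blocks.\<close>
lemma diag_block_mat_map_eqI:
  assumes "\<And>j. j \<in> set js \<Longrightarrow> F j \<in> carrier_mat k k"
    and "A \<in> carrier_mat (k * length js) (k * length js)"
    and "\<And>i l. i < k * length js \<Longrightarrow> l < k * length js \<Longrightarrow>
      A $$ (i, l) = (if i div k = l div k then F (js ! (i div k)) $$ (i mod k, l mod k) else 0)"
  shows "diag_block_mat (map F js) = A"
proof -
  have c: "diag_block_mat (map F js) \<in> carrier_mat (k * length js) (k * length js)"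
    by (rule diag_block_mat_map_carrier) (rule assms(1))
  show ?thesis
    by (rule eq_matI)
      (use c assms(2) in \<open>auto simp: assms(3) diag_block_mat_map_index[OF assms(1)]\<close>)
qed

lemma block_index_bounds:
  fixes i k p :: nat
  assumes "i < k * p"
  shows "i div k < p" "i mod k < k" "0 < k"
proof -
  show k: "0 < k" using assms by (cases k) auto
  show "i div k < p" using assms by (simp add: less_mult_imp_div_less mult.commute)
  show "i mod k < k" using k by simp
qed

section \<open>Complex numbers as blocks of order two\<close>

text \<open>The matrix of multiplication by a complex number, in the orientation for which
  \<open>skew_block t\<close> represents \<open>\<i> t\<close>. So \<open>rot_diag p\<close> represents \<open>p\<close>-tuples of complex
  numbers by commuting real matrices, with transposition as complex conjugation.\<close>
definition rot :: "complex \<Rightarrow> real mat" where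
  "rot z = mat_of_rows_list 2 [[Re z, Im z], [- Im z, Re z]]"

definition rot_diag :: "nat \<Rightarrow> (nat \<Rightarrow> complex) \<Rightarrow> real mat" where
  "rot_diag p z = block_diag p (\<lambda>j. rot (z j))"

lemma less_2_cases: "i < 2 \<Longrightarrow> (i::nat) = 0 \<or> i = Suc 0"
  by auto

lemma rot_carrier [simp]: "rot z \<in> carrier_mat 2 2"
  by (simp add: rot_def mat_of_rows_list_def carrier_matI)

lemma rot_index [simp]:
  "rot z $$ (0, 0) = Re z" "rot z $$ (0, Suc 0) = Im z"
  "rot z $$ (Suc 0, 0) = - Im z" "rot z $$ (Suc 0, Suc 0) = Re z"
  by (simp_all add: rot_def mat_of_rows_list_def)

lemma rot_dim [simp]: "dim_row (rot z) = 2" "dim_col (rot z) = 2"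
  using rot_carrier[of z] by (blast dest: carrier_matD)+

lemma mat2_eqI:
  assumes "A \<in> carrier_mat 2 2" "B \<in> carrier_mat 2 2"
    "A $$ (0,0) = B $$ (0,0)" "A $$ (0,Suc 0) = B $$ (0,Suc 0)"
    "A $$ (Suc 0,0) = B $$ (Suc 0,0)" "A $$ (Suc 0,Suc 0) = B $$ (Suc 0,Suc 0)"
  shows "A = B"
  by (rule eq_matI) (use assms in \<open>auto dest!: less_2_cases\<close>)

lemma mult2_index:
  assumes "A \<in> carrier_mat 2 2" "B \<in> carrier_mat 2 2" "i < 2" "l < 2"
  shows "(A * B) $$ (i, l) = A $$ (i, 0) * B $$ (0, l) + A $$ (i, Suc 0) * B $$ (Suc 0, l)"
  using assms by (simp add: scalar_prod_def numeral_2_eq_2)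

lemma rot_mult: "rot z * rot w = rot (z * w)"
  by (rule mat2_eqI) (auto simp: mult2_index mult_carrier_mat[of _ 2 2] simp del: index_mult_mat)

lemma skew_block_eq_rot: "skew_block t = rot (\<i> * t)"
  by (simp add: skew_block_def rot_def)

lemma smult_one_eq_rot: "a \<cdot>\<^sub>m 1\<^sub>m 2 = rot (of_real a)"
  by (rule mat2_eqI) auto

lemma rot_diag_carrier [simp]: "rot_diag p z \<in> carrier_mat (2 * p) (2 * p)"
  using diag_block_mat_map_carrier[of "[0..<p]" "\<lambda>j. rot (z j)" 2]
  by (simp add: rot_diag_def block_diag_def)

lemma rot_diag_dim [simp]: "dim_row (rot_diag p z) = 2 * p" "dim_col (rot_diag p z) = 2 * p"
  using rot_diag_carrier[of p z] by (blast dest: carrier_matD)+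

lemma rot_diag_index:
  assumes "i < 2 * p" "l < 2 * p"
  shows "rot_diag p z $$ (i, l) =
    (if i div 2 = l div 2 then rot (z (i div 2)) $$ (i mod 2, l mod 2) else 0)"
  using assms diag_block_mat_map_index[of "[0..<p]" "\<lambda>j. rot (z j)" 2 i l]
    block_index_bounds(1)[OF assms(1)]
  by (simp add: rot_diag_def block_diag_def)

lemma rot_diag_mult: "rot_diag p z * rot_diag p w = rot_diag p (\<lambda>j. z j * w j)"
  using diag_block_mat_map_mult[of "[0..<p]" "\<lambda>j. rot (z j)" 2 "\<lambda>j. rot (w j)"]
  by (simp add: rot_diag_def block_diag_def rot_mult)

lemma rot_index_add: "i < 2 \<Longrightarrow> l < 2 \<Longrightarrow> rot (z + w) $$ (i, l) = rot z $$ (i, l) + rot w $$ (i, l)"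
  by (auto dest!: less_2_cases)

lemma rot_index_diff: "i < 2 \<Longrightarrow> l < 2 \<Longrightarrow> rot (z - w) $$ (i, l) = rot z $$ (i, l) - rot w $$ (i, l)"
  by (auto dest!: less_2_cases)

lemma rot_index_cnj: "i < 2 \<Longrightarrow> l < 2 \<Longrightarrow> rot (cnj z) $$ (i, l) = rot z $$ (l, i)"
  by (auto dest!: less_2_cases)

lemma rot_index_uminus: "i < 2 \<Longrightarrow> l < 2 \<Longrightarrow> rot (- z) $$ (i, l) = - rot z $$ (i, l)"
  by (auto dest!: less_2_cases)

lemma rot_index_real: "i < 2 \<Longrightarrow> l < 2 \<Longrightarrow> rot (of_real r) $$ (i, l) = (if i = l then r else 0)"
  by (auto dest!: less_2_cases)

lemma rot_diag_add: "rot_diag p z + rot_diag p w = rot_diag p (\<lambda>j. z j + w j)"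
  by (rule eq_matI) (auto simp: rot_diag_index rot_index_add)

lemma rot_diag_minus: "rot_diag p z - rot_diag p w = rot_diag p (\<lambda>j. z j - w j)"
  by (rule eq_matI) (auto simp: rot_diag_index rot_index_diff)

lemma rot_diag_uminus: "- rot_diag p z = rot_diag p (\<lambda>j. - z j)"
  by (rule eq_matI) (auto simp: rot_diag_index rot_index_uminus)

lemma rot_diag_transpose: "(rot_diag p z)\<^sup>T = rot_diag p (\<lambda>j. cnj (z j))"
  by (rule eq_matI) (auto simp: rot_diag_index rot_index_cnj)

lemma rot_diag_real: "rot_diag p (\<lambda>j. of_real (r j)) = mat_diag (2 * p) (\<lambda>i. r (i div 2))"
proof (rule eq_matI)
  have eq: "i = l" if "i div 2 = l div 2" "i mod 2 = l mod 2" for i l :: nat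
    using that by (metis div_mult_mod_eq)
  show "rot_diag p (\<lambda>j. of_real (r j)) $$ (i, l) = mat_diag (2 * p) (\<lambda>i. r (i div 2)) $$ (i, l)"
    if "i < dim_row (mat_diag (2 * p) (\<lambda>i. r (i div 2)))"
      "l < dim_col (mat_diag (2 * p) (\<lambda>i. r (i div 2)))" for i l
    using that by (auto simp: mat_diag_def rot_diag_index rot_index_real dest: eq)
qed (auto simp: mat_diag_def)

lemma rot_diag_one: "1\<^sub>m (2 * p) = rot_diag p (\<lambda>j. 1)"
  using rot_diag_real[of p "\<lambda>_. 1"] by simp

section \<open>Passing between conjugate pairs and real and imaginary parts\<close>

text \<open>The columns are eigenvectors of every \<open>rot z\<close>, with eigenvalues \<open>z\<close> and \<open>cnj z\<close>. Up to the
  factor \<open>sqrt 2\<close> the matrix is unitary, and right multiplication by it turns the columns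
  \<open>Re v\<close>, \<open>Im v\<close> into \<open>v\<close> and its conjugate.\<close>
definition conj_block :: "complex mat" where
  "conj_block = mat_of_rows_list 2 [[1, 1], [\<i>, - \<i>]]"

definition conj_basis :: "nat \<Rightarrow> complex mat" where
  "conj_basis p = diag_block_mat (map (\<lambda>_. conj_block) [0..<p])"

text \<open>The sequence \<open>z 0, conjugate (z 0), z 1, conjugate (z 1), ...\<close>; the type class covers the
  eigenvalues as well as the eigenvectors.\<close>
definition conj_pairs :: "(nat \<Rightarrow> 'a::conjugate) \<Rightarrow> nat \<Rightarrow> 'a" where
  "conj_pairs z k = (if even k then z (k div 2) else conjugate (z (k div 2)))"

lemma conj_block_carrier [simp]: "conj_block \<in> carrier_mat 2 2"
  by (simp add: conj_block_def mat_of_rows_list_def carrier_matI)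

lemma conj_block_dim [simp]: "dim_row conj_block = 2" "dim_col conj_block = 2"
  using conj_block_carrier by (blast dest: carrier_matD)+

lemma conj_block_index [simp]:
  "conj_block $$ (0, 0) = 1" "conj_block $$ (0, Suc 0) = 1"
  "conj_block $$ (Suc 0, 0) = \<i>" "conj_block $$ (Suc 0, Suc 0) = - \<i>"
  by (simp_all add: conj_block_def mat_of_rows_list_def)

lemma conj_basis_carrier [simp]: "conj_basis p \<in> carrier_mat (2 * p) (2 * p)"
  using diag_block_mat_map_carrier[of "[0..<p]" "\<lambda>j. conj_block" 2]
  by (simp add: conj_basis_def)

lemma conj_basis_dim [simp]: "dim_row (conj_basis p) = 2 * p" "dim_col (conj_basis p) = 2 * p"
  using conj_basis_carrier[of p] by (blast dest: carrier_matD)+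

lemma conj_basis_index:
  assumes "i < 2 * p" "l < 2 * p"
  shows "conj_basis p $$ (i, l) =
    (if i div 2 = l div 2 then conj_block $$ (i mod 2, l mod 2) else 0)"
  using assms diag_block_mat_map_index[of "[0..<p]" "\<lambda>j. conj_block" 2 i l]
  by (simp add: conj_basis_def)

lemma mat_adjoint_index:
  "i < dim_col A \<Longrightarrow> l < dim_row A \<Longrightarrow> mat_adjoint A $$ (i, l) = conjugate (A $$ (l, i))"
  by (simp add: mat_adjoint_alt)

lemma mat_adjoint_conj_basis:
  "mat_adjoint (conj_basis p) = diag_block_mat (map (\<lambda>_. mat_adjoint conj_block) [0..<p])"
  by (rule diag_block_mat_map_eqI[of _ _ 2, symmetric])
    (auto simp: mat_adjoint_index conj_basis_index carrier_matI)

lemma diag_block_mat_two: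
  "diag_block_mat (map (\<lambda>_. 2 \<cdot>\<^sub>m 1\<^sub>m 2) [0..<p]) = (2 \<cdot>\<^sub>m 1\<^sub>m (2 * p) :: complex mat)"
proof (rule diag_block_mat_map_eqI[of _ _ 2])
  have eq: "i = l" if "i div 2 = l div 2" "i mod 2 = l mod 2" for i l :: nat
    using that by (metis div_mult_mod_eq)
  fix i l assume "i < 2 * length [0..<p]" "l < 2 * length [0..<p]"
  then show "(2 \<cdot>\<^sub>m 1\<^sub>m (2 * p) :: complex mat) $$ (i, l) =
    (if i div 2 = l div 2 then (2 \<cdot>\<^sub>m 1\<^sub>m 2) $$ (i mod 2, l mod 2) else 0)"
    by (auto dest: eq)
qed auto

lemma conj_basis_adjoint:
  "conj_basis p * mat_adjoint (conj_basis p) = 2 \<cdot>\<^sub>m 1\<^sub>m (2 * p)"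
  "mat_adjoint (conj_basis p) * conj_basis p = 2 \<cdot>\<^sub>m 1\<^sub>m (2 * p)"
proof -
  have c: "mat_adjoint conj_block \<in> carrier_mat 2 2" by (simp add: carrier_matI)
  have "conj_block * mat_adjoint conj_block = 2 \<cdot>\<^sub>m 1\<^sub>m 2"
       "mat_adjoint conj_block * conj_block = 2 \<cdot>\<^sub>m 1\<^sub>m 2"
    by (rule mat2_eqI; simp add: c mult2_index mat_adjoint_index mult_carrier_mat[of _ 2 2] del: index_mult_mat)+
  then show "conj_basis p * mat_adjoint (conj_basis p) = 2 \<cdot>\<^sub>m 1\<^sub>m (2 * p)"
    "mat_adjoint (conj_basis p) * conj_basis p = 2 \<cdot>\<^sub>m 1\<^sub>m (2 * p)"
    unfolding mat_adjoint_conj_basis unfolding conj_basis_def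
    by (simp_all add: diag_block_mat_map_mult[where k = 2] c diag_block_mat_two)
qed

lemma conj_basis_cancel_right:
  assumes "Y \<in> carrier_mat n (2 * p)" "Z \<in> carrier_mat n (2 * p)"
    and "Y * conj_basis p = Z * conj_basis p"
  shows "Y = Z"
proof (rule smult_cancel[where c = 2])
  have e: "W * conj_basis p * mat_adjoint (conj_basis p) = 2 \<cdot>\<^sub>m W" if "W \<in> carrier_mat n (2 * p)" for W
    using that by (simp add: mult_assoc_dim conj_basis_adjoint mult_smult_dim)
  show "2 \<cdot>\<^sub>m Y = 2 \<cdot>\<^sub>m Z" using assms(3) e[OF assms(1)] e[OF assms(2)] by simp
qed simp

lemma conj_basis_cancel_left:
  assumes "Y \<in> carrier_mat (2 * p) n" "Z \<in> carrier_mat (2 * p) n"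
    and "mat_adjoint (conj_basis p) * Y = mat_adjoint (conj_basis p) * Z"
  shows "Y = Z"
proof (rule smult_cancel[where c = 2])
  have e: "conj_basis p * (mat_adjoint (conj_basis p) * W) = 2 \<cdot>\<^sub>m W"
    if "W \<in> carrier_mat (2 * p) n" for W
    using that by (simp add: mult_assoc_dim[symmetric] conj_basis_adjoint mult_smult_dim)
  show "2 \<cdot>\<^sub>m Y = 2 \<cdot>\<^sub>m Z" using assms(3) e[OF assms(1)] e[OF assms(2)] by simp
qed simp

lemma sum_pair_block:
  fixes b p :: nat
  assumes "b < p" "\<And>k. k < 2 * p \<Longrightarrow> k div 2 \<noteq> b \<Longrightarrow> f k = 0"
  shows "(\<Sum>k\<in>{0..<2*p}. f k) = f (2 * b) + (f (2 * b + 1) :: 'a::comm_monoid_add)"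
proof -
  have "(\<Sum>k\<in>{0..<2*p}. f k) = sum f {2 * b, 2 * b + 1}"
  proof (rule sum.mono_neutral_right)
    show "\<forall>k\<in>{0..<2 * p} - {2 * b, 2 * b + 1}. f k = 0"
    proof
      fix k assume k: "k \<in> {0..<2 * p} - {2 * b, 2 * b + 1}"
      then have "k div 2 \<noteq> b" by auto
      then show "f k = 0" using k assms(2) by auto
    qed
  qed (use assms in auto)
  then show ?thesis by simp
qed

text \<open>Column \<open>k\<close> of \<open>conj_basis\<close> is supported on the two rows of its block.\<close>
lemma mult_conj_basis_index:
  assumes "A \<in> carrier_mat m (2 * p)" "i < m" "k < 2 * p"
  shows "(A * conj_basis p) $$ (i, k) =
    A $$ (i, 2 * (k div 2)) + (if even k then \<i> else - \<i>) * A $$ (i, 2 * (k div 2) + 1)"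
proof -
  have b: "k div 2 < p" using assms by auto
  have "(A * conj_basis p) $$ (i, k) = (\<Sum>l\<in>{0..<2*p}. A $$ (i, l) * conj_basis p $$ (l, k))"
    using assms by (simp add: scalar_prod_def)
  also have "\<dots> = A $$ (i, 2 * (k div 2)) * conj_basis p $$ (2 * (k div 2), k)
      + A $$ (i, 2 * (k div 2) + 1) * conj_basis p $$ (2 * (k div 2) + 1, k)"
    by (rule sum_pair_block[OF b]) (use assms in \<open>auto simp: conj_basis_index\<close>)
  finally have "(A * conj_basis p) $$ (i, k) =
      A $$ (i, 2 * (k div 2)) * conj_basis p $$ (2 * (k div 2), k)
      + A $$ (i, 2 * (k div 2) + 1) * conj_basis p $$ (2 * (k div 2) + 1, k)" .
  moreover have "conj_basis p $$ (2 * (k div 2), k) = 1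
    \<and> conj_basis p $$ (2 * (k div 2) + 1, k) = (if even k then \<i> else - \<i>)"
    using assms b by (auto elim!: evenE oddE simp: conj_basis_index)
  ultimately show ?thesis
    by (simp add: mult.commute)
qed

text \<open>One change of basis diagonalizes all matrices \<open>rot_diag p z\<close> at once.\<close>
lemma rot_diag_conj_basis:
  "cmat (rot_diag p z) * conj_basis p = conj_basis p * mat_diag (2 * p) (conj_pairs z)"
proof (rule eq_matI)
  fix i k assume "i < dim_row (conj_basis p * mat_diag (2 * p) (conj_pairs z))"
    "k < dim_col (conj_basis p * mat_diag (2 * p) (conj_pairs z))"
  then have ik: "i < 2 * p" "k < 2 * p" by (auto simp: mat_diag_def)
  have "k div 2 < p" using ik by auto
  then have b: "2 * (k div 2) < 2 * p" "Suc (2 * (k div 2)) < 2 * p" by linarith+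
  have "(cmat (rot_diag p z) * conj_basis p) $$ (i, k) = cmat (rot_diag p z) $$ (i, 2 * (k div 2))
    + (if even k then \<i> else - \<i>) * cmat (rot_diag p z) $$ (i, 2 * (k div 2) + 1)"
    by (rule mult_conj_basis_index) (use ik in auto)
  also have "\<dots> = conj_basis p $$ (i, k) * conj_pairs z k"
  proof -
    obtain a c where "i = 2 * a \<or> i = Suc (2 * a)" "k = 2 * c \<or> k = Suc (2 * c)"
      by (metis evenE oddE Suc_eq_plus1)
    then show ?thesis
      using ik b by (elim disjE; simp add: rot_diag_index conj_basis_index conj_pairs_def complex_eq_iff)
  qed
  also have "\<dots> = (conj_basis p * mat_diag (2 * p) (conj_pairs z)) $$ (i, k)"
    using ik by (simp add: mat_diag_mult_right[OF conj_basis_carrier])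
  finally show "(cmat (rot_diag p z) * conj_basis p) $$ (i, k) =
    (conj_basis p * mat_diag (2 * p) (conj_pairs z)) $$ (i, k)" .
qed (auto simp: mat_diag_def)

lemma length_concat_pairs: "length (concat (map (\<lambda>i. [f i, g i]) [0..<p])) = 2 * p"
  by (induct p) auto

lemma concat_pairs_nth:
  "k < 2 * p \<Longrightarrow> concat (map (\<lambda>i. [f i, g i]) [0..<p]) ! k = (if even k then f (k div 2) else g (k div 2))"
proof (induct p)
  case (Suc p)
  show ?case
  proof (cases "k < 2 * p")
    case False
    then have "k = 2 * p \<or> k = Suc (2 * p)" using Suc by auto
    then show ?thesis by (auto simp: nth_append length_concat_pairs)
  qed (use Suc in \<open>auto simp: nth_append length_concat_pairs\<close>)
qed auto

lemma re_im_mat_carrier: "re_im_mat n p x \<in> carrier_mat n (2 * p)"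
  unfolding re_im_mat_def by (rule carrier_matI) (simp_all add: length_concat_pairs)

lemma conj_pair_mat_carrier: "conj_pair_mat n p x \<in> carrier_mat n (2 * p)"
  unfolding conj_pair_mat_def by (rule carrier_matI) (simp_all add: length_concat_pairs)

lemma conj_pair_mat_col:
  assumes "k < 2 * p" "\<And>i. i < p \<Longrightarrow> x i \<in> carrier_vec n"
  shows "col (conj_pair_mat n p x) k = conj_pairs x k"
proof -
  have b: "k div 2 < p" using assms by auto
  show ?thesis using assms(2)[OF b] assms(1) unfolding conj_pair_mat_def
    by (subst col_mat_of_cols) (auto simp: length_concat_pairs concat_pairs_nth conj_pairs_def)
qed

text \<open>This links the two normal forms of the eigenvector data: identities for complex eigenvector
  columns become identities for real and imaginary parts after cancelling \<open>conj_basis\<close>.\<close>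
lemma conj_pair_mat_eq:
  assumes "\<And>i. i < p \<Longrightarrow> x i \<in> carrier_vec n"
  shows "conj_pair_mat n p x = cmat (re_im_mat n p x) * conj_basis p"
proof (rule eq_matI)
  fix i k assume "i < dim_row (cmat (re_im_mat n p x) * conj_basis p)"
    "k < dim_col (cmat (re_im_mat n p x) * conj_basis p)"
  then have ik: "i < n" "k < 2 * p" using re_im_mat_carrier[of n p x] by auto
  have kp: "k div 2 < p" using ik by auto
  then have b: "2 * (k div 2) < 2 * p" "Suc (2 * (k div 2)) < 2 * p" by linarith+
  have xc: "x (k div 2) \<in> carrier_vec n" using assms[OF kp] .
  have "(cmat (re_im_mat n p x) * conj_basis p) $$ (i, k) = cmat (re_im_mat n p x) $$ (i, 2 * (k div 2))
    + (if even k then \<i> else - \<i>) * cmat (re_im_mat n p x) $$ (i, 2 * (k div 2) + 1)"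
    by (rule mult_conj_basis_index) (use ik re_im_mat_carrier[of n p x] in auto)
  also have "\<dots> = of_real (Re (x (k div 2) $ i)) + (if even k then \<i> else - \<i>) * of_real (Im (x (k div 2) $ i))"
    using ik b xc re_im_mat_carrier[of n p x]
    by (auto simp: re_im_mat_def mat_of_cols_index length_concat_pairs concat_pairs_nth)
  also have "\<dots> = conj_pair_mat n p x $$ (i, k)"
    using ik b xc
    by (auto simp: conj_pair_mat_def mat_of_cols_index length_concat_pairs concat_pairs_nth complex_eq_iff)
  finally show "conj_pair_mat n p x $$ (i, k) = (cmat (re_im_mat n p x) * conj_basis p) $$ (i, k)" ..
qed (use re_im_mat_carrier[of n p x] conj_pair_mat_carrier[of n p x] in auto)

section \<open>Rank and spectrum\<close>

text \<open>A vector in the kernel of \<open>X\<close>, or two equal columns, would be visible in \<open>Y * X = 1\<close>; this is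
  how orthonormality with respect to \<open>M\<close> yields the rank condition of a deflating pair.\<close>
lemma left_inverse_full_rank:
  fixes X :: "'a::field mat"
  assumes X: "X \<in> carrier_mat n p" and Y: "Y \<in> carrier_mat p n" and YX: "Y * X = 1\<^sub>m p"
  shows "vec_space.rank n X = p" "p \<le> n"
proof -
  interpret vec_space "TYPE('a)" n .
  have colYX: "Y *\<^sub>v col X k = unit_vec p k" if "k < p" for k
  proof -
    have "Y *\<^sub>v col X k = col (Y * X) k" by (rule col_mult2[OF Y X that, symmetric])
    then show ?thesis using that by (simp only: YX col_one)
  qed
  have dist: "distinct (cols X)"
    unfolding distinct_conv_nth
  proof (intro allI impI)
    fix i j assume ij: "i < length (cols X)" "j < length (cols X)" "i \<noteq> j"
    have "unit_vec p i \<noteq> (unit_vec p j :: 'a vec)"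
    proof
      assume "unit_vec p i = (unit_vec p j :: 'a vec)"
      then have "unit_vec p i $ i = (unit_vec p j :: 'a vec) $ i" by simp
      then show False using ij X by (simp add: unit_vec_def split: if_splits)
    qed
    then show "cols X ! i \<noteq> cols X ! j"
      using ij X colYX[of i] colYX[of j] by auto
  qed
  have indpt: "lin_indpt (set (cols X))"
  proof
    assume "lin_dep (set (cols X))"
    then obtain v where v: "v \<in> carrier_vec p" "v \<noteq> 0\<^sub>v p" "X *\<^sub>v v = 0\<^sub>v n"
      using lin_depE[OF X _ dist] by blast
    have "v = (Y * X) *\<^sub>v v" using YX v by simp
    also have "\<dots> = Y *\<^sub>v (X *\<^sub>v v)" by (rule assoc_mult_mat_vec[OF Y X v(1)])
    also have "\<dots> = 0\<^sub>v p" using v(3) Y by auto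
    finally show False using v by simp
  qed
  show "vec_space.rank n X = p" by (rule lin_indpt_full_rank[OF X dist indpt])
  have "card (set (cols X)) = p" using distinct_card[OF dist] X by simp
  moreover have "card (set (cols X)) \<le> dim"
    by (rule li_le_dim(2)) (use indpt X cols_dim[of X] in auto)
  ultimately show "p \<le> n" by (simp add: dim_is_n)
qed

lemma pencil_eigenvectors_mat:
  fixes M K X :: "'a::comm_ring_1 mat"
  assumes M: "M \<in> carrier_mat n n" and K: "K \<in> carrier_mat n n" and X: "X \<in> carrier_mat n m"
    and ev: "\<And>k. k < m \<Longrightarrow> pencil_eigenvector n M K (col X k) (d k)"
  shows "M * X * mat_diag m d + K * X = 0\<^sub>m n m"
proof (rule eq_matI)
  fix i k assume "i < dim_row (0\<^sub>m n m :: 'a mat)" "k < dim_col (0\<^sub>m n m :: 'a mat)"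
  then have ik: "i < n" "k < m" by auto
  have MX: "M * X \<in> carrier_mat n m" using M X by simp
  have "((d k \<cdot>\<^sub>m M + K) *\<^sub>v col X k) $ i = 0"
    using ev[OF ik(2)] ik by (simp add: pencil_eigenvector_def pencil_eval_def)
  also have "((d k \<cdot>\<^sub>m M + K) *\<^sub>v col X k) $ i = d k * (row M i \<bullet> col X k) + row K i \<bullet> col X k"
    using M K X ik
    by (simp add: scalar_prod_def sum_distrib_left distrib_right sum.distrib mult.assoc)
  finally show "(M * X * mat_diag m d + K * X) $$ (i, k) = 0\<^sub>m n m $$ (i, k)"
    using M K X ik by (simp add: mat_diag_mult_right[OF MX] mult.commute)
qed (use M K X in \<open>auto simp: mat_diag_def\<close>)

lemma diagonalization_spectrum:
  fixes A T S :: "'a::field mat"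
  assumes A: "A \<in> carrier_mat m m" and T: "T \<in> carrier_mat m m" and S: "S \<in> carrier_mat m m"
    and diag: "A * T = T * mat_diag m d" and ST: "S * T = c \<cdot>\<^sub>m 1\<^sub>m m" and c: "c \<noteq> 0" and k: "k < m"
  shows "d k \<in> spectrum A"
proof -
  have "col T k \<noteq> 0\<^sub>v m"
  proof
    assume 0: "col T k = 0\<^sub>v m"
    have "(S * T) $$ (k, k) = row S k \<bullet> col T k" using S T k by simp
    also have "\<dots> = 0" using 0 S k by simp
    finally show False using ST c k by simp
  qed
  moreover have "A *\<^sub>v col T k = d k \<cdot>\<^sub>v col T k"
  proof (rule eq_vecI)
    fix i assume "i < dim_vec (d k \<cdot>\<^sub>v col T k)"
    then have i: "i < m" using T by simp
    show "(A *\<^sub>v col T k) $ i = (d k \<cdot>\<^sub>v col T k) $ i"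
      using arg_cong[OF diag, of "\<lambda>Z. Z $$ (i, k)"] i k A T
      by (simp add: mat_diag_mult_right[OF T] mult.commute)
  qed (use A T in auto)
  ultimately have "eigenvector A (col T k) (d k)"
    using A T by (auto simp: eigenvector_def)
  then show ?thesis by (auto simp: spectrum_def eigenvalue_def)
qed

text \<open>The uniqueness theorem for Sylvester equations in the case of a diagonal left coefficient,
  where it is elementary: each nonzero row of \<open>S\<close> is an eigenvector of \<open>B\<^sup>T\<close>.
  The sign matches the spectral condition of the theorem.\<close>
lemma diagonal_intertwiner_zero:
  fixes S B :: "'a::field mat"
  assumes S: "S \<in> carrier_mat m q" and B: "B \<in> carrier_mat q q"
    and SB: "S * B = mat_diag m d * S"
    and disj: "\<And>k. k < m \<Longrightarrow> - d k \<notin> spectrum (- B\<^sup>T)"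
  shows "S = 0\<^sub>m m q"
proof -
  have "row S k = 0\<^sub>v q" if k: "k < m" for k
  proof (rule ccontr)
    assume nz: "row S k \<noteq> 0\<^sub>v q"
    have "(- B\<^sup>T) *\<^sub>v row S k = (- d k) \<cdot>\<^sub>v row S k"
    proof (rule eq_vecI)
      fix j assume "j < dim_vec ((- d k) \<cdot>\<^sub>v row S k)"
      then have j: "j < q" using S by simp
      have "(S * B) $$ (k, j) = (mat_diag m d * S) $$ (k, j)" using SB by simp
      then have "row S k \<bullet> col B j = d k * S $$ (k, j)"
        using k j S B by (simp add: mat_diag_mult_left[OF S])
      moreover have "row (- B\<^sup>T) j \<bullet> row S k = - (row S k \<bullet> col B j)"
        using k j S B by (simp add: scalar_prod_def sum_negf mult.commute)
      ultimately show "((- B\<^sup>T) *\<^sub>v row S k) $ j = ((- d k) \<cdot>\<^sub>v row S k) $ j"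
        using k j S B by simp
    qed (use S B in auto)
    then have "eigenvector (- B\<^sup>T) (row S k) (- d k)"
      using nz S B by (auto simp: eigenvector_def)
    then show False using disj[OF k] by (auto simp: spectrum_def eigenvalue_def)
  qed
  then have "S $$ (k, j) = 0" if "k < m" "j < q" for k j
    using that S by (metis index_row(1) index_zero_vec(1) carrier_matD)
  then show ?thesis using S by (intro eq_matI) auto
qed

text \<open>Multiplying the eigenvalue equation by the adjoint of \<open>X\<close> shows that \<open>- 2 * mat_diag m d\<close>
  equals a congruence of \<open>K\<close>, which is skew-Hermitian.\<close>
lemma T_odd_eigenvalues_imaginary:
  fixes M K :: "real mat"
  assumes odd: "T_odd n M K" and X: "X \<in> carrier_mat n m"
    and gram: "mat_adjoint X * cmat M * X = 2 \<cdot>\<^sub>m 1\<^sub>m m"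
    and pair: "cmat M * X * mat_diag m d + cmat K * X = 0\<^sub>m n m" and k: "k < m"
  shows "Re (d k) = 0"
proof -
  have M: "M \<in> carrier_mat n n" and K: "K \<in> carrier_mat n n" "K\<^sup>T = - K"
    using odd by (auto simp: T_odd_def)
  note dm = carrier_matD[OF M] carrier_matD[OF K(1)] carrier_matD[OF X]
    carrier_matD[OF mat_diag_dim]
  define N where "N = mat_adjoint X * (cmat K * X)"
  have Nc: "N \<in> carrier_mat m m" by (rule carrier_matI) (simp_all add: N_def dm)
  have gram': "mat_adjoint X * (cmat M * X) = 2 \<cdot>\<^sub>m 1\<^sub>m m"
    using gram by (simp add: mult_assoc_dim dm)
  have "cmat K * X = - (cmat M * X * mat_diag m d)"
    using eq_uminus_mat[OF pair] M K X by (simp add: mult_carrier_mat[of _ n m _ m])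
  then have "N = - (mat_adjoint X * (cmat M * X) * mat_diag m d)"
    by (simp add: N_def mat_dim_simps dm)
  then have "N = - (2 \<cdot>\<^sub>m mat_diag m d)"
    by (simp add: gram' mult_smult_dim dm)
  then have Nkk: "N $$ (k, k) = - 2 * d k" using k by (simp add: mat_diag_def)
  have cK: "(cmat K)\<^sup>T = - cmat K"
    unfolding cmat_transpose[symmetric] K(2) by (intro eq_matI) auto
  have "mat_adjoint (cmat K) = - cmat K"
    by (simp add: mat_adjoint_cmat cmat_transpose cK)
  then have "mat_adjoint N = - N"
    by (simp add: N_def mat_adjoint_mult mat_adjoint_adjoint mat_dim_simps dm)
  then have "mat_adjoint N $$ (k, k) = (- N) $$ (k, k)" by simp
  then have "cnj (N $$ (k, k)) = - N $$ (k, k)" using k Nc by (simp add: mat_adjoint_index)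
  then show ?thesis unfolding Nkk by (simp add: complex_eq_iff)
qed

section \<open>Low-rank updates of odd pencils\<close>

text \<open>Since \<open>X\<^sup>T * M * X = 1\<close>, the updates act on \<open>X\<close> as \<open>M * X * P\<close> and \<open>M * X * Q\<close>. The left-hand
  side is therefore \<open>M * X * (A + P * A + Q) + K * X\<close>, and the last assumption makes the bracket
  equal to \<open>C\<close>.\<close>
lemma update_replaces_pair:
  fixes M K X A :: "'a::comm_ring_1 mat"
  assumes M: "M \<in> carrier_mat n n" and K: "K \<in> carrier_mat n n" and X: "X \<in> carrier_mat n m"
    and C: "C \<in> carrier_mat m m" and A: "A \<in> carrier_mat m m"
    and P: "P \<in> carrier_mat m m" and Q: "Q \<in> carrier_mat m m"
    and orth: "X\<^sup>T * M * X = 1\<^sub>m m" and pair: "M * X * C + K * X = 0\<^sub>m n m"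
    and PQ: "P * A + Q = C - A"
  shows "(M + M * X * P * X\<^sup>T * M) * X * A + (K + M * X * Q * X\<^sup>T * M) * X = 0\<^sub>m n m"
proof -
  note d = carrier_matD[OF M] carrier_matD[OF K] carrier_matD[OF X] carrier_matD[OF C]
    carrier_matD[OF A] carrier_matD[OF P] carrier_matD[OF Q]
  have orth': "X\<^sup>T * (M * X) = 1\<^sub>m m" using orth by (simp add: mult_assoc_dim d)
  have c1: "X\<^sup>T * (M * (X * A)) = A"
    using arg_cong[OF orth', of "\<lambda>Z. Z * A"] by (simp add: mult_assoc_dim d A)
  have "(M + M * X * P * X\<^sup>T * M) * X * A = M * (X * A) + M * (X * (P * A))"
    by (simp add: mat_dim_simps d c1)
  moreover have "(K + M * X * Q * X\<^sup>T * M) * X = K * X + M * (X * Q)"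
    by (simp add: mat_dim_simps d orth')
  moreover have "K * X = - (M * (X * C))"
    using eq_uminus_mat[OF pair] M K X C by (simp add: mult_assoc_dim d)
  moreover have "M * (X * C) = M * (X * A) + (M * (X * (P * A)) + M * (X * Q))"
  proof -
    have "C = A + (P * A + Q)"
      unfolding PQ using A C by (intro eq_matI) auto
    then have "M * (X * C) = M * (X * (A + (P * A + Q)))" by simp
    then show ?thesis by (simp add: mat_dim_simps d)
  qed
  ultimately show ?thesis
    using M X A P Q C by (intro eq_matI) auto
qed

text \<open>No spill-over: the updates end in \<open>X\<^sup>T * M\<close>, which annihilates \<open>Y\<close>.\<close>
lemma update_keeps_pair:
  fixes M K X Y :: "'a::comm_ring_1 mat"
  assumes M: "M \<in> carrier_mat n n" and K: "K \<in> carrier_mat n n" and X: "X \<in> carrier_mat n m"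
    and P: "P \<in> carrier_mat m m" and Q: "Q \<in> carrier_mat m m"
    and Y: "Y \<in> carrier_mat n q" and B: "B \<in> carrier_mat q q"
    and orth: "X\<^sup>T * M * Y = 0\<^sub>m m q" and pair: "M * Y * B + K * Y = 0\<^sub>m n q"
  shows "(M + M * X * P * X\<^sup>T * M) * Y * B + (K + M * X * Q * X\<^sup>T * M) * Y = 0\<^sub>m n q"
proof -
  note d = carrier_matD[OF M] carrier_matD[OF K] carrier_matD[OF X]
    carrier_matD[OF P] carrier_matD[OF Q] carrier_matD[OF Y] carrier_matD[OF B]
  have orth': "X\<^sup>T * (M * Y) = 0\<^sub>m m q" using orth by (simp add: mult_assoc_dim d)
  have "X\<^sup>T * (M * (Y * B)) = 0\<^sub>m m q"
    using arg_cong[OF orth', of "\<lambda>Z. Z * B"] by (simp add: mult_assoc_dim d B)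
  then have "(M + M * X * P * X\<^sup>T * M) * Y * B + (K + M * X * Q * X\<^sup>T * M) * Y
    = (M * (Y * B) + 0\<^sub>m n q) + (K * Y + 0\<^sub>m n q)"
    by (simp add: mat_dim_simps d orth')
  also have "\<dots> = M * Y * B + K * Y"
    using M K Y B by (simp add: mult_assoc_dim d)
  finally show ?thesis using pair by simp
qed

text \<open>Evaluating \<open>X\<^sup>T * K * Y\<close> with either of the two deflating equations shows that \<open>X\<^sup>T * M * Y\<close>
  solves a Sylvester equation; it vanishes once the spectra are disjoint.\<close>
lemma pairs_bilinear:
  fixes M K X Y :: "'a::comm_ring_1 mat"
  assumes M: "M \<in> carrier_mat n n" and K: "K \<in> carrier_mat n n" and X: "X \<in> carrier_mat n m"
    and C: "C \<in> carrier_mat m m" and Y: "Y \<in> carrier_mat n q" and B: "B \<in> carrier_mat q q"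
    and odd: "M\<^sup>T = M" "K\<^sup>T = - K" and skew: "C\<^sup>T = - C"
    and pX: "M * X * C + K * X = 0\<^sub>m n m" and pY: "M * Y * B + K * Y = 0\<^sub>m n q"
  shows "X\<^sup>T * M * Y * B = C * (X\<^sup>T * M * Y)"
proof -
  note d = carrier_matD[OF M] carrier_matD[OF K] carrier_matD[OF X] carrier_matD[OF C]
    carrier_matD[OF Y] carrier_matD[OF B]
  have KX: "K * X = - (M * X * C)" using eq_uminus_mat[OF pX] M K X C by simp
  have KY: "M * Y * B = - (K * Y)" using eq_uminus_mat[of "K * Y" "M * Y * B" n q] pY M K Y B
    by (simp add: comm_add_mat[of _ n q])
  have "X\<^sup>T * M * Y * B = X\<^sup>T * (M * Y * B)" by (simp add: mult_assoc_dim d)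
  also have "\<dots> = (X\<^sup>T * - K) * Y" unfolding KY by (simp add: mat_dim_simps d)
  also have "\<dots> = (K * X)\<^sup>T * Y" by (simp add: transpose_mult_dim d odd)
  also have "\<dots> = C * (X\<^sup>T * M * Y)"
  proof -
    have "(K * X)\<^sup>T = (- (M * X * C))\<^sup>T" using KX by simp
    also have "\<dots> = - (M * X * C)\<^sup>T" by (intro eq_matI) auto
    also have "\<dots> = C * (X\<^sup>T * M)" by (simp add: mat_dim_simps d odd skew)
    finally show ?thesis by (simp add: mult_assoc_dim d)
  qed
  finally show ?thesis .
qed

lemma T_odd_update:
  fixes M K X :: "'a::comm_ring_1 mat"
  assumes odd: "T_odd n M K" and X: "X \<in> carrier_mat n m"
    and P: "P \<in> carrier_mat m m" "P\<^sup>T = P" and Q: "Q \<in> carrier_mat m m" "Q\<^sup>T = - Q"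
  shows "T_odd n (M + M * X * P * X\<^sup>T * M) (K + M * X * Q * X\<^sup>T * M)"
proof -
  have M: "M \<in> carrier_mat n n" "M\<^sup>T = M" and K: "K \<in> carrier_mat n n" "K\<^sup>T = - K"
    using odd by (auto simp: T_odd_def)
  note d = carrier_matD[OF M(1)] carrier_matD[OF K(1)] carrier_matD[OF X]
    carrier_matD[OF P(1)] carrier_matD[OF Q(1)]
  have "(M * X * P * X\<^sup>T * M)\<^sup>T = M * X * P * X\<^sup>T * M"
    by (simp add: mat_dim_simps d M P)
  moreover have "(M * X * Q * X\<^sup>T * M)\<^sup>T = - (M * X * Q * X\<^sup>T * M)"
    by (simp add: mat_dim_simps d M Q)
  moreover have c: "M * X * P * X\<^sup>T * M \<in> carrier_mat n n" "M * X * Q * X\<^sup>T * M \<in> carrier_mat n n"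
    by (rule carrier_matI; simp add: d)+
  ultimately show ?thesis
    using M K by (auto simp: T_odd_def transpose_add[of _ n n] intro!: eq_matI)
qed

text \<open>With \<open>w = X\<^sup>T * M * v\<close> the quadratic form is \<open>\<Sum>i<m. r i * (w $ i)\<^sup>2\<close>.\<close>
lemma congruence_pos_semidef:
  assumes M: "M \<in> carrier_mat n n" "M\<^sup>T = M" and X: "X \<in> carrier_mat n m"
    and r: "\<And>i. i < m \<Longrightarrow> r i \<ge> 0"
  shows "pos_semidef n (M * X * mat_diag m r * X\<^sup>T * M)" (is "pos_semidef n ?A")
  unfolding pos_semidef_def
proof (intro conjI ballI)
  have D: "mat_diag m r \<in> carrier_mat m m" "(mat_diag m r)\<^sup>T = mat_diag m r"
    by (auto simp: mat_diag_def)
  note d = carrier_matD[OF M(1)] carrier_matD[OF X] carrier_matD[OF D(1)]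
  show A: "?A \<in> carrier_mat n n" by (rule carrier_matI) (simp_all add: d)
  show "?A\<^sup>T = ?A" by (simp add: mat_dim_simps d M D)
  fix v :: "real vec" assume v: "v \<in> carrier_vec n"
  define w where "w = X\<^sup>T *\<^sub>v (M *\<^sub>v v)"
  have w: "w \<in> carrier_vec m" using X M v by (auto simp: w_def)
  have "?A *\<^sub>v v = M * X *\<^sub>v (mat_diag m r *\<^sub>v w)"
    using M X D v by (simp add: w_def assoc_mult_mat_vec[of _ n n _ n] assoc_mult_mat_vec[of _ n m _ n]
      assoc_mult_mat_vec[of _ n m _ m] mult_carrier_mat[of _ n m _ m] mult_carrier_mat[of _ n n _ m] mult_carrier_mat[of _ n m _ n])
  then have "v \<bullet> (?A *\<^sub>v v) = v \<bullet> (M * X *\<^sub>v (mat_diag m r *\<^sub>v w))" by (simp only:)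
  also have "\<dots> = ((M * X)\<^sup>T *\<^sub>v v) \<bullet> (mat_diag m r *\<^sub>v w)"
    by (rule transpose_vec_mult_scalar[symmetric])
      (use M X v w mult_mat_vec_carrier[OF D(1) w] in auto)
  also have "(M * X)\<^sup>T *\<^sub>v v = w"
    using M X v by (simp add: transpose_mult_dim w_def assoc_mult_mat_vec[of _ m n _ n])
  also have "mat_diag m r *\<^sub>v w = vec m (\<lambda>i. r i * w $ i)"
    by (rule eq_vecI) (use w in \<open>auto simp: mat_diag_def scalar_prod_def if_distrib[of "\<lambda>a. a * _"] cong: if_cong\<close>)
  also have "w \<bullet> vec m (\<lambda>i. r i * w $ i) = (\<Sum>i<m. r i * (w $ i)\<^sup>2)"
    by (simp add: scalar_prod_def power2_eq_square lessThan_atLeast0 mult.left_commute)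
  also have "\<dots> \<ge> 0" by (rule sum_nonneg) (use r in auto)
  finally show "v \<bullet> (?A *\<^sub>v v) \<ge> 0" .
qed

lemma pos_def_add_pos_semidef:
  assumes "pos_def n A" "pos_semidef n B"
  shows "pos_def n (A + B)"
  unfolding pos_def_def
proof (intro conjI ballI impI)
  have A: "A \<in> carrier_mat n n" and B: "B \<in> carrier_mat n n"
    using assms by (auto simp: pos_def_def pos_semidef_def)
  then show "A + B \<in> carrier_mat n n" by simp
  show "(A + B)\<^sup>T = A + B"
    using assms A B by (simp add: pos_def_def pos_semidef_def transpose_add[of _ n n])
  fix v :: "real vec" assume v: "v \<in> carrier_vec n" "v \<noteq> 0\<^sub>v n"
  have "v \<bullet> ((A + B) *\<^sub>v v) = v \<bullet> (A *\<^sub>v v) + v \<bullet> (B *\<^sub>v v)"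
    using A B v by (simp add: add_mult_distrib_mat_vec[of _ n n] scalar_prod_add_distrib[of _ n])
  then show "v \<bullet> ((A + B) *\<^sub>v v) > 0"
    using assms v by (auto simp: pos_def_def pos_semidef_def intro: add_pos_nonneg)
qed

lemma mat_inv_eq:
  fixes A B :: "'a::field mat"
  assumes A: "A \<in> carrier_mat n n" and B: "B \<in> carrier_mat n n"
    and AB: "A * B = 1\<^sub>m n" and BA: "B * A = 1\<^sub>m n"
  shows "mat_inv A = B"
proof (cases "mat_inverse A")
  case None
  then have "A \<notin> Units (ring_mat TYPE('a) n ())" by (rule mat_inverse(1)[OF A])
  moreover have "A \<in> Units (ring_mat TYPE('a) n ())"
    using A B AB BA by (auto simp: Units_def ring_mat_def)
  ultimately show ?thesis by simp
next
  case (Some C)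
  then have C: "A * C = 1\<^sub>m n" "C \<in> carrier_mat n n" using mat_inverse(2)[OF A] by auto
  have "C = (B * A) * C" using C BA by simp
  also have "\<dots> = B" using A B C by (simp add: assoc_mult_mat[of _ n n _ n _ n])
  finally show ?thesis using Some by (simp add: mat_inv_def)
qed

section \<open>Replacing eigenvalues without spill-over\<close>

theorem mainTheorem8:
  fixes n p :: nat
    and M K Xh Lc La Z1 Z2 Ha Mh Kh DM DK :: "real mat"
    and lamc lama :: "nat \<Rightarrow> complex"
    and x :: "nat \<Rightarrow> complex vec"
    and Xc Xf Lf :: "complex mat"
    and \<alpha> \<beta> :: "nat \<Rightarrow> real"
  assumes odd: "T_odd n M K"
    and pd: "pos_def n M"
    and lamc_nz: "\<And>i. i < p \<Longrightarrow> lamc i \<noteq> 0"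
    and eig: "\<And>i. i < p \<Longrightarrow> pencil_eigenvector n (cmat M) (cmat K) (x i) (lamc i)"
    and eig_cnj: "\<And>i. i < p \<Longrightarrow>
          pencil_eigenvector n (cmat M) (cmat K) (conjugate (x i)) (cnj (lamc i))"
    and Xc: "Xc = conj_pair_mat n p x"
    and normalized: "mat_adjoint Xc * cmat M * Xc = 2 \<cdot>\<^sub>m 1\<^sub>m (2 * p)"
    and Xh: "Xh = re_im_mat n p x"
    and lama_im: "\<And>i. i < p \<Longrightarrow> Re (lama i) = 0"
    and Lc: "Lc = block_diag p (\<lambda>j. skew_block (Im (lamc j)))"
    and La: "La = block_diag p (\<lambda>j. skew_block (Im (lama j)))"
    and defl: "deflating_pair n (cmat M) (cmat K) (Xf, Lf)"
    and compl: "complementary (cmat Xh, cmat Lc) (Xf, Lf)"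
    and spec: "spectrum (cmat Lc) \<inter> spectrum (- Lf\<^sup>T) = {}"
    and Z1: "Z1 = block_diag p (\<lambda>j. \<alpha> j \<cdot>\<^sub>m 1\<^sub>m 2)"
    and Z2: "Z2 = block_diag p (\<lambda>j. skew_block (\<beta> j))"
    and Ha: "Ha = mat_inv (1\<^sub>m (2 * p) - La * La)"
    and Mh: "Mh = Ha * ((La - Lc) * La + Z1 + Z2 * La)"
    and Kh: "Kh = Ha * ((Lc - La) - Z1 * La - Z2 * (La * La))"
    and DM: "DM = M * Xh * Mh * Xh\<^sup>T * M"
    and DK: "DK = M * Xh * Kh * Xh\<^sup>T * M"
  shows
    "(\<forall>i<p. Re (lamc i) = 0) \<and> Xh\<^sup>T * M * Xh = 1\<^sub>m (2 * p) \<and>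
     deflating_pair n (cmat M) (cmat K) (cmat Xh, cmat Lc) \<and>
     invertible_mat (1\<^sub>m (2 * p) - La * La) \<and>
     deflating_pair n (cmat (M + DM)) (cmat (K + DK)) (cmat Xh, cmat La) \<and>
     deflating_pair n (cmat (M + DM)) (cmat (K + DK)) (Xf, Lf) \<and>
     complementary (cmat Xh, cmat La) (Xf, Lf) \<and>
     T_odd n (M + DM) (K + DK) \<and>
     (diagonal_mat ((La - Lc) * La + Z1 + Z2 * La) \<and>
      (\<forall>i < 2 * p. ((La - Lc) * La + Z1 + Z2 * La) $$ (i, i) \<ge> 0) \<longrightarrow>
      pos_semidef n DM \<and> pos_def n (M + DM))"
proof -
  have M: "M \<in> carrier_mat n n" "M\<^sup>T = M" and K: "K \<in> carrier_mat n n" "K\<^sup>T = - K"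
    using odd by (auto simp: T_odd_def)
  have xc: "x i \<in> carrier_vec n" if "i < p" for i
    using eig[OF that] by (simp add: pencil_eigenvector_def)
  have Xhc: "Xh \<in> carrier_mat n (2 * p)" and Xcc: "Xc \<in> carrier_mat n (2 * p)"
    unfolding Xh Xc by (rule re_im_mat_carrier conj_pair_mat_carrier)+
  have XcT: "Xc = cmat Xh * conj_basis p"
    unfolding Xc Xh by (rule conj_pair_mat_eq[OF xc])
  have ev: "pencil_eigenvector n (cmat M) (cmat K) (col Xc k) (conj_pairs lamc k)" if k: "k < 2 * p" for k
  proof -
    have "k div 2 < p" using k by auto
    then show ?thesis
      unfolding Xc using eig[of "k div 2"] eig_cnj[of "k div 2"]
      by (subst conj_pair_mat_col[OF k xc]) (auto simp: conj_pairs_def)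
  qed
  have re0: "Re (lamc i) = 0" if i: "i < p" for i
  proof -
    have "Re (conj_pairs lamc (2 * i)) = 0"
      by (rule T_odd_eigenvalues_imaginary[OF odd Xcc normalized])
        (use i ev M K Xcc in \<open>auto intro!: pencil_eigenvectors_mat\<close>)
    then show ?thesis by (simp add: conj_pairs_def)
  qed

  define zc za where "zc = (\<lambda>j. \<i> * complex_of_real (Im (lamc j)))"
    and "za = (\<lambda>j. \<i> * complex_of_real (Im (lama j)))"
  let ?D = "mat_diag (2 * p) (conj_pairs zc)"
  \<comment> \<open>Only the values below \<open>p\<close> of \<open>lamc\<close> are known to be imaginary; \<open>zc\<close> and \<open>za\<close> are
     imaginary everywhere, so that identities between them hold as functions.\<close>
  have zc: "conj_pairs zc k = conj_pairs lamc k" if "k < 2 * p" for k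
  proof -
    have "k div 2 < p" using that by auto
    then show ?thesis using re0 by (simp add: conj_pairs_def zc_def complex_eq_iff)
  qed
  have Lc': "Lc = rot_diag p zc" and La': "La = rot_diag p za"
    by (simp_all add: Lc La rot_diag_def zc_def za_def skew_block_eq_rot)
  have Z1': "Z1 = rot_diag p (\<lambda>j. of_real (\<alpha> j))" and Z2': "Z2 = rot_diag p (\<lambda>j. \<i> * of_real (\<beta> j))"
    by (simp_all add: Z1 Z2 rot_diag_def skew_block_eq_rot smult_one_eq_rot)
  have Lcc: "Lc \<in> carrier_mat (2 * p) (2 * p)" and Lac: "La \<in> carrier_mat (2 * p) (2 * p)"
    by (simp_all add: Lc' La')
  have LcT: "Lc\<^sup>T = - Lc"
    by (simp add: Lc' rot_diag_transpose rot_diag_uminus zc_def)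
  note dm = carrier_matD[OF M(1)] carrier_matD[OF K(1)] carrier_matD[OF Xhc] carrier_matD[OF Xcc]
    carrier_matD[OF Lcc] carrier_matD[OF Lac] carrier_matD[OF mat_diag_dim]

  have gram: "Xh\<^sup>T * M * Xh = 1\<^sub>m (2 * p)"
  proof -
    let ?T = "conj_basis p"
    have "mat_adjoint ?T * (cmat (Xh\<^sup>T * M * Xh) * ?T) = mat_adjoint ?T * (1\<^sub>m (2 * p) * ?T)"
      using normalized
      by (simp add: XcT mat_adjoint_mult mat_adjoint_cmat cmat_mult mult_assoc_dim dm conj_basis_adjoint)
    then have "cmat (Xh\<^sup>T * M * Xh) * ?T = 1\<^sub>m (2 * p) * ?T"
      by (rule conj_basis_cancel_left[rotated 2]) (auto simp: dm intro!: carrier_matI)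
    then have "cmat (Xh\<^sup>T * M * Xh) = 1\<^sub>m (2 * p)"
      by (rule conj_basis_cancel_right[rotated 2]) (auto simp: dm intro!: carrier_matI)
    then show ?thesis by (intro cmat_inj) (simp add: cmat_one)
  qed
  have LT: "cmat Lc * conj_basis p = conj_basis p * ?D"
    unfolding Lc' by (rule rot_diag_conj_basis)
  have pairc: "cmat M * cmat Xh * cmat Lc + cmat K * cmat Xh = 0\<^sub>m n (2 * p)"
  proof (rule conj_basis_cancel_right)
    have "cmat M * Xc * ?D + cmat K * Xc = 0\<^sub>m n (2 * p)"
      by (rule pencil_eigenvectors_mat) (use ev zc M K Xcc in auto)
    then show "(cmat M * cmat Xh * cmat Lc + cmat K * cmat Xh) * conj_basis p
        = 0\<^sub>m n (2 * p) * conj_basis p"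
      by (simp add: XcT mat_dim_simps dm LT)
  qed (auto simp: dm intro!: carrier_matI)
  have pairr: "M * Xh * Lc + K * Xh = 0\<^sub>m n (2 * p)"
    by (rule cmat_inj) (use pairc in \<open>simp add: cmat_add cmat_mult cmat_zero dm\<close>)
  have rankXh: "vec_space.rank n (cmat Xh) = 2 * p" "2 * p \<le> n"
  proof -
    have "cmat (Xh\<^sup>T * M) * cmat Xh = 1\<^sub>m (2 * p)"
      using arg_cong[OF gram, of cmat] by (simp add: cmat_mult cmat_one dm)
    then show "vec_space.rank n (cmat Xh) = 2 * p" "2 * p \<le> n"
      by (intro left_inverse_full_rank[of "cmat Xh" n "2 * p" "cmat (Xh\<^sup>T * M)"]; use Xhc M in simp)+
  qed

  have w: "1 - za j * za j = of_real (1 + (Im (lama j))\<^sup>2)" for j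
    by (simp add: za_def power2_eq_square complex_eq_iff)
  have pos: "1 + (Im (lama j))\<^sup>2 > 0" for j by (simp add: add_pos_nonneg)
  define h where "h = (\<lambda>j. complex_of_real (1 / (1 + (Im (lama j))\<^sup>2)))"
  have hw: "h j * (1 - za j * za j) = 1" for j
    unfolding w h_def of_real_mult[symmetric] using pos[of j] by simp
  have I: "1\<^sub>m (2 * p) - La * La = rot_diag p (\<lambda>j. 1 - za j * za j)"
    by (simp add: La' rot_diag_one rot_diag_mult rot_diag_minus)
  have inv: "(1\<^sub>m (2 * p) - La * La) * rot_diag p h = 1\<^sub>m (2 * p)"
    "rot_diag p h * (1\<^sub>m (2 * p) - La * La) = 1\<^sub>m (2 * p)"
    unfolding I rot_diag_mult by (simp_all add: hw rot_diag_one mult.commute[of _ "h _"])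
  have Ha': "Ha = rot_diag p h"
    unfolding Ha by (rule mat_inv_eq[OF _ _ inv]) (auto simp: I)
  have invI: "invertible_mat (1\<^sub>m (2 * p) - La * La)"
    unfolding invertible_mat_def inverts_mat_def
    using inv by (auto simp: I intro!: exI[of _ "rot_diag p h"])

  let ?E = "(La - Lc) * La + Z1 + Z2 * La"
  \<comment> \<open>Products of two imaginary numbers are real: hence \<open>Mh\<close> is a real multiple of the identity on
     each block, for all choices of the parameters.\<close>
  define s where "s = (\<lambda>j. - (Im (lama j) - Im (lamc j)) * Im (lama j) + \<alpha> j - \<beta> j * Im (lama j))"
  have E: "?E = rot_diag p (\<lambda>j. of_real (s j))"
  proof -
    have "?E = rot_diag p (\<lambda>j. (za j - zc j) * za j + of_real (\<alpha> j) + \<i> * of_real (\<beta> j) * za j)"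
      by (simp add: La' Lc' Z1' Z2' rot_diag_mult rot_diag_add rot_diag_minus)
    also have "(\<lambda>j. (za j - zc j) * za j + of_real (\<alpha> j) + \<i> * of_real (\<beta> j) * za j) = (\<lambda>j. of_real (s j))"
      by (rule ext) (simp add: za_def zc_def s_def complex_eq_iff algebra_simps)
    finally show ?thesis .
  qed
  define r where "r = (\<lambda>j. 1 / (1 + (Im (lama j))\<^sup>2) * s j)"
  have Mh': "Mh = rot_diag p (\<lambda>j. of_real (r j))"
    unfolding Mh E Ha' rot_diag_mult by (simp add: h_def r_def)
  define u where "u = (\<lambda>j. (zc j - za j) - of_real (\<alpha> j) * za j - \<i> * of_real (\<beta> j) * (za j * za j))"
  have Kh': "Kh = rot_diag p (\<lambda>j. h j * u j)"
    by (simp add: Kh Ha' La' Lc' Z1' Z2' rot_diag_mult rot_diag_minus u_def)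
  have Mhc: "Mh \<in> carrier_mat (2 * p) (2 * p)" "Mh\<^sup>T = Mh"
    by (simp_all add: Mh' rot_diag_transpose)
  have Khc: "Kh \<in> carrier_mat (2 * p) (2 * p)" "Kh\<^sup>T = - Kh"
  proof -
    have "cnj (h j) = h j" "cnj (u j) = - u j" for j
      by (simp_all add: h_def u_def za_def zc_def)
    then have "cnj (h j * u j) = - (h j * u j)" for j by simp
    then show "Kh\<^sup>T = - Kh" by (simp add: Kh' rot_diag_transpose rot_diag_uminus del: complex_cnj_mult)
  qed (simp add: Kh')
  \<comment> \<open>In the commutative algebra the two free parameters cancel, and the factor
     \<open>1 - za j * za j\<close> that remains is the one inverted by \<open>h\<close>.\<close>
  have PQ: "Mh * La + Kh = Lc - La"
  proof -
    have "Mh * La + Kh = rot_diag p (\<lambda>j. h j * ((za j - zc j) * za j + of_real (\<alpha> j) + \<i> * of_real (\<beta> j) * za j) * za j + h j * u j)"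
      by (simp add: Mh Kh' Ha' La' Lc' Z1' Z2' rot_diag_mult rot_diag_add rot_diag_minus)
    also have "(\<lambda>j. h j * ((za j - zc j) * za j + of_real (\<alpha> j) + \<i> * of_real (\<beta> j) * za j) * za j + h j * u j)
        = (\<lambda>j. (h j * (1 - za j * za j)) * (zc j - za j))"
      by (rule ext) (simp add: u_def algebra_simps)
    finally show ?thesis by (simp add: hw Lc' La' rot_diag_minus)
  qed
  note dm2 = carrier_matD[OF Mhc(1)] carrier_matD[OF Khc(1)]

  have upd: "(M + DM) * Xh * La + (K + DK) * Xh = 0\<^sub>m n (2 * p)"
    unfolding DM DK
    by (rule update_replaces_pair[OF M(1) K(1) Xhc Lcc Lac Mhc(1) Khc(1) gram pairr PQ])
  have DMc: "DM \<in> carrier_mat n n" and DKc: "DK \<in> carrier_mat n n"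
    unfolding DM DK by (rule carrier_matI; simp add: dm dm2)+
  have deflX: "deflating_pair n (cmat (M + DM)) (cmat (K + DK)) (cmat Xh, cmat La)"
    using arg_cong[OF upd, of cmat] rankXh Xhc Lac M(1) K(1) DMc DKc
    by (simp add: deflating_pair_def cmat_add cmat_mult cmat_zero)
  have defl0: "deflating_pair n (cmat M) (cmat K) (cmat Xh, cmat Lc)"
    using pairc rankXh Xhc Lcc by (simp add: deflating_pair_def)

  obtain q where q: "q \<le> n" "Xf \<in> carrier_mat n q" "Lf \<in> carrier_mat q q"
    "vec_space.rank n Xf = q" "cmat M * Xf * Lf + cmat K * Xf = 0\<^sub>m n q"
    using defl by (auto simp: deflating_pair_def)
  have cM: "cmat M \<in> carrier_mat n n" "(cmat M)\<^sup>T = cmat M"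
    using M by (simp_all flip: cmat_transpose)
  have cK: "cmat K \<in> carrier_mat n n" "(cmat K)\<^sup>T = - cmat K"
    using K(1) unfolding cmat_transpose[symmetric] K(2) by (auto intro!: eq_matI)
  have cL: "cmat Lc \<in> carrier_mat (2 * p) (2 * p)" "(cmat Lc)\<^sup>T = - cmat Lc"
    using Lcc unfolding cmat_transpose[symmetric] LcT by (auto intro!: eq_matI)
  have cX: "cmat Xh \<in> carrier_mat n (2 * p)" using Xhc by simp
  define S where "S = (cmat Xh)\<^sup>T * cmat M * Xf"
  have Sc: "S \<in> carrier_mat (2 * p) q"
    unfolding S_def using q(2) by (intro carrier_matI) (simp_all add: dm)
  have SL: "S * Lf = cmat Lc * S"
    unfolding S_def
    by (rule pairs_bilinear[OF cM(1) cK(1) cX cL(1) q(2,3) cM(2) cK(2) cL(2) pairc q(5)])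
  have S0: "S = 0\<^sub>m (2 * p) q"
  proof (rule conj_basis_cancel_left[OF Sc])
    let ?A = "mat_adjoint (conj_basis p)"
    have AL: "?A * cmat Lc = ?D * ?A"
    proof (rule conj_basis_cancel_right)
      have "?A * cmat Lc * conj_basis p = 2 \<cdot>\<^sub>m ?D"
        by (simp add: mult_assoc_dim dm LT) 
          (simp add: mult_assoc_dim[symmetric] dm conj_basis_adjoint mult_smult_dim)
      also have "\<dots> = ?D * ?A * conj_basis p"
        by (simp add: mult_assoc_dim dm conj_basis_adjoint mult_smult_dim)
      finally show "?A * cmat Lc * conj_basis p = ?D * ?A * conj_basis p" .
    qed (auto simp: dm intro!: carrier_matI)
    have "?A * S = 0\<^sub>m (2 * p) q"
    proof (rule diagonal_intertwiner_zero)
      show "?A * S \<in> carrier_mat (2 * p) q" using Sc by (intro carrier_matI) auto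
      show "Lf \<in> carrier_mat q q" by (rule q)
      have "?A * S * Lf = ?A * (cmat Lc * S)"
        using SL Sc q(3) by (simp add: mult_assoc_dim)
      also have "\<dots> = (?A * cmat Lc) * S"
        using Sc by (simp add: mult_assoc_dim dm)
      also have "\<dots> = ?D * (?A * S)"
        unfolding AL using Sc by (simp add: mult_assoc_dim dm)
      finally show "?A * S * Lf = ?D * (?A * S)" .
      fix k assume k: "k < 2 * p"
      have spec_in: "conj_pairs zc l \<in> spectrum (cmat Lc)" if "l < 2 * p" for l
        by (rule diagonalization_spectrum[OF cL(1) conj_basis_carrier _ LT conj_basis_adjoint(2) _ that])
          (auto intro!: carrier_matI)
      \<comment> \<open>The other eigenvalue of the same block: the spectrum of \<open>Lc\<close> is symmetric under negation,
         which reconciles the sign in the spectral condition with \<open>S * Lf = Lc * S\<close>.\<close>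
      obtain l where l: "l < 2 * p" "- conj_pairs zc k = conj_pairs zc l"
      proof (cases "even k")
        case True
        then show ?thesis using k
          by (intro that[of "Suc k"]) (auto elim!: evenE simp: conj_pairs_def zc_def)
      next
        case False
        then show ?thesis using k
          by (intro that[of "k - 1"]) (auto elim!: oddE simp: conj_pairs_def zc_def)
      qed
      show "- conj_pairs zc k \<notin> spectrum (- Lf\<^sup>T)"
        using spec spec_in[OF l(1)] l(2) by auto
    qed
    then show "?A * S = ?A * 0\<^sub>m (2 * p) q" by simp
  qed simp
  have deflf: "deflating_pair n (cmat (M + DM)) (cmat (K + DK)) (Xf, Lf)"
  proof -
    have "(cmat M + cmat M * cmat Xh * cmat Mh * (cmat Xh)\<^sup>T * cmat M) * Xf * Lf
      + (cmat K + cmat M * cmat Xh * cmat Kh * (cmat Xh)\<^sup>T * cmat M) * Xf = 0\<^sub>m n q"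
      by (rule update_keeps_pair[OF cM(1) cK(1) cX _ _ q(2,3) S0[unfolded S_def] q(5)])
        (use Mhc Khc in simp_all)
    moreover have "cmat (M + DM) = cmat M + cmat M * cmat Xh * cmat Mh * (cmat Xh)\<^sup>T * cmat M"
      "cmat (K + DK) = cmat K + cmat M * cmat Xh * cmat Kh * (cmat Xh)\<^sup>T * cmat M"
      by (simp_all add: DM DK cmat_add cmat_mult cmat_transpose dm dm2)
    ultimately show ?thesis using q by (simp add: deflating_pair_def)
  qed

  have psd: "pos_semidef n DM" if diag: "diagonal_mat ?E" "\<forall>i < 2 * p. ?E $$ (i, i) \<ge> 0"
  proof -
    have "r (i div 2) \<ge> 0" if i: "i < 2 * p" for i
    proof -
      have "s (i div 2) = ?E $$ (i, i)" using i unfolding E rot_diag_real by (simp add: mat_diag_def)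
      then show ?thesis using diag(2) i pos[of "i div 2"] by (simp add: r_def)
    qed
    then show ?thesis
      unfolding DM Mh' rot_diag_real using M Xhc by (intro congruence_pos_semidef)
  qed
  have "complementary (cmat Xh, cmat La) (Xf, Lf)"
    using compl by (simp add: complementary_def)
  moreover have "T_odd n (M + DM) (K + DK)"
    unfolding DM DK by (rule T_odd_update[OF odd Xhc Mhc Khc])
  ultimately show ?thesis
    using re0 gram defl0 invI deflX deflf psd pos_def_add_pos_semidef[OF pd] by blast
qed

end
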